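(* Let $\mathcal{H}$ be a separable Hilbert space and let $E=(E_{n,k})_{n,k\geq1}$ be an infinite matrix which defines a matrix mapping on $\bigoplus_{n=1}^\infty\mathcal{H}$. Then $E$ induces a bounded operator on the Hilbert space $\bigoplus_{n=1}^\infty\mathcal{H}$; that is, the map $\Psi=\{\psi_k\}_{k=1}^\infty\mapsto E\Psi=\{\sum_{k=1}^\infty E_{n,k}\psi_k\}_{n=1}^\infty$ is a bounded linear operator from $\bigoplus_{n=1}^\infty\mathcal{H}$ to itself.
   Context: Matrices have real or complex entries (scalars of the Hilbert space). $\bigoplus_{n=1}^\infty\mathcal{H}$ is the Hilbert space of sequences $\{f_n\}_{n=1}^\infty$ in $\mathcal{H}$ with $\sum_n\|f_n\|^2<\infty$, with inner product $\sum_n\langle f_n,g_n\rangle$. $E$ defines a matrix mapping on a sequence space $\mathcal X$ if for every $x=\{x_k\}\in\mathcal X$ the series $(Ex)_n=\sum_{k=1}^\infty E_{n,k}x_k$ converges for every $n\in\mathbb{N}$ and $Ex=\{(Ex)_n\}_{n=1}^\infty\in\mathcal X$. *)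

theory Defs
  imports "HOL-Analysis.Analysis"
begin

text \<open>
  Real Hilbert spaces are the types of sort \<open>{real_inner, complete_space}\<close>. The class below
  provides the complex counterpart. It extends \<open>real_inner\<close>, so that norm and topology are
  inherited; the real inner product of a complex space is the real part of the complex one.
  The complex inner product is linear in its first argument.
\<close>

class complex_inner = real_inner +
  fixes scaleC :: "complex \<Rightarrow> 'a \<Rightarrow> 'a" (infixr \<open>*\<^sub>C\<close> 75)
    and cinner :: "'a \<Rightarrow> 'a \<Rightarrow> complex"
  assumes scaleC_add_right: "c *\<^sub>C (x + y) = c *\<^sub>C x + c *\<^sub>C y"
    and scaleC_add_left: "(c + d) *\<^sub>C x = c *\<^sub>C x + d *\<^sub>C x"
    and scaleC_scaleC: "c *\<^sub>C (d *\<^sub>C x) = (c * d) *\<^sub>C x"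
    and scaleR_scaleC: "r *\<^sub>R x = complex_of_real r *\<^sub>C x"
    and cinner_commute: "cinner x y = cnj (cinner y x)"
    and cinner_add_left: "cinner (x + y) z = cinner x z + cinner y z"
    and cinner_scaleC_left: "cinner (c *\<^sub>C x) y = c * cinner x y"
    and inner_eq_Re_cinner: "inner x y = Re (cinner x y)"
begin

lemma cinner_scaleC_right: "cinner x (c *\<^sub>C y) = cnj c * cinner x y"
  by (metis cinner_commute cinner_scaleC_left complex_cnj_mult)

lemma cinner_self: "cinner x x = complex_of_real ((norm x)\<^sup>2)"
proof (rule complex_eqI)
  show "Re (cinner x x) = Re (complex_of_real ((norm x)\<^sup>2))"
    by (simp add: power2_norm_eq_inner inner_eq_Re_cinner)
  have "Im (cinner x x) = - Im (cinner x x)"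
    by (metis cinner_commute cnj.simps(2))
  then show "Im (cinner x x) = Im (complex_of_real ((norm x)\<^sup>2))" by simp
qed

lemma norm_scaleC: "norm (c *\<^sub>C x) = cmod c * norm x"
proof -
  have "cinner (c *\<^sub>C x) (c *\<^sub>C x) = (c * cnj c) * cinner x x"
    by (simp add: cinner_scaleC_left cinner_scaleC_right)
  also have "\<dots> = complex_of_real ((cmod c * norm x)\<^sup>2)"
    by (simp add: cinner_self complex_norm_square[symmetric] power_mult_distrib)
  finally have "(norm (c *\<^sub>C x))\<^sup>2 = (cmod c * norm x)\<^sup>2"
    unfolding cinner_self of_real_eq_iff .
  moreover have "0 \<le> norm y" for y by (simp add: norm_eq_sqrt_inner)
  ultimately show ?thesis by (simp add: power2_eq_iff_nonneg)
qed

lemma cinner_eq_inner: "cinner x y = Complex (inner x y) (inner x (\<i> *\<^sub>C y))"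
  by (simp add: complex_eq_iff inner_eq_Re_cinner cinner_scaleC_right)

end

instantiation complex :: complex_inner
begin
definition scaleC_complex :: "complex \<Rightarrow> complex \<Rightarrow> complex"
  where "scaleC_complex c x = c * x"
definition cinner_complex :: "complex \<Rightarrow> complex \<Rightarrow> complex"
  where "cinner_complex x y = x * cnj y"
instance
  by standard (auto simp: scaleC_complex_def cinner_complex_def algebra_simps
      scaleR_conv_of_real inner_complex_def)
end

definition bounded_clinear :: "('a::complex_inner \<Rightarrow> 'b::complex_inner) \<Rightarrow> bool"
  where "bounded_clinear T \<longleftrightarrow> bounded_linear T \<and> (\<forall>c x. T (c *\<^sub>C x) = c *\<^sub>C T x)"


definition l2_seqs :: "(nat \<Rightarrow> 'a::real_normed_vector) set"
  where "l2_seqs = {f. summable (\<lambda>n. (norm (f n))\<^sup>2)}"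

lemma l2_seqs_zero: "(\<lambda>n. 0) \<in> l2_seqs"
  by (simp add: l2_seqs_def)

lemma l2_seqs_add:
  assumes "f \<in> l2_seqs" "g \<in> l2_seqs"
  shows "(\<lambda>n. f n + g n) \<in> l2_seqs"
proof -
  have "summable (\<lambda>n. 2 * (norm (f n))\<^sup>2 + 2 * (norm (g n))\<^sup>2)"
    using assms by (auto simp: l2_seqs_def intro!: summable_add summable_mult)
  moreover have "(norm (f n + g n))\<^sup>2 \<le> 2 * (norm (f n))\<^sup>2 + 2 * (norm (g n))\<^sup>2" for n
  proof -
    have "(norm (f n + g n))\<^sup>2 \<le> (norm (f n) + norm (g n))\<^sup>2"
      by (intro power_mono norm_triangle_ineq) auto
    also have "\<dots> \<le> 2 * (norm (f n))\<^sup>2 + 2 * (norm (g n))\<^sup>2"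
      using sum_squares_bound[of "norm (f n)" "norm (g n)"] by (simp add: power2_sum)
    finally show ?thesis .
  qed
  ultimately show ?thesis
    unfolding l2_seqs_def mem_Collect_eq by - (rule summable_comparison_test'[where N = 0], auto)
qed

lemma l2_seqs_bounded_by:
  assumes "f \<in> l2_seqs" "\<And>n. norm (g n) \<le> c * norm (f n)"
  shows "g \<in> l2_seqs"
proof -
  have sm: "summable (\<lambda>n. c\<^sup>2 * (norm (f n))\<^sup>2)"
    using assms by (auto simp: l2_seqs_def intro!: summable_mult)
  have b: "(norm (g n))\<^sup>2 \<le> c\<^sup>2 * (norm (f n))\<^sup>2" for n
    using power_mono[OF assms(2)[of n], of 2] by (simp add: power_mult_distrib)
  show ?thesis
    unfolding l2_seqs_def mem_Collect_eq
    by (rule summable_comparison_test'[OF sm, where N = 0]) (simp add: b)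
qed

lemma l2_seqs_summable_inner:
  fixes f g :: "nat \<Rightarrow> 'a::real_inner"
  assumes "f \<in> l2_seqs" "g \<in> l2_seqs"
  shows "summable (\<lambda>n. inner (f n) (g n))"
proof -
  have "summable (\<lambda>n. (norm (f n))\<^sup>2 + (norm (g n))\<^sup>2)"
    using assms by (auto simp: l2_seqs_def intro!: summable_add)
  moreover have "norm (inner (f n) (g n)) \<le> (norm (f n))\<^sup>2 + (norm (g n))\<^sup>2" for n
  proof -
    have "norm (inner (f n) (g n)) \<le> norm (f n) * norm (g n)"
      using Cauchy_Schwarz_ineq2 by simp
    also have "\<dots> \<le> (norm (f n))\<^sup>2 + (norm (g n))\<^sup>2"
      using sum_squares_bound[of "norm (f n)" "norm (g n)"]
        mult_nonneg_nonneg[OF norm_ge_zero norm_ge_zero, of "f n" "g n"] by linarith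
    finally show ?thesis .
  qed
  ultimately show ?thesis by - (rule summable_comparison_test'[where N = 0], auto)
qed

text \<open>
  The Hilbert space direct sum of countably many copies of \<open>'a\<close>; sequences are indexed by
  \<open>0, 1, 2, \<dots>\<close>.
\<close>

typedef (overloaded) 'a l2sum = "l2_seqs :: (nat \<Rightarrow> 'a::real_inner) set"
  morphisms seq_of to_l2sum
  using l2_seqs_zero by blast

setup_lifting type_definition_l2sum

instantiation l2sum :: (real_inner) real_inner
begin

lift_definition zero_l2sum :: "'a l2sum" is "\<lambda>n. 0"
  by (rule l2_seqs_zero)

lift_definition plus_l2sum :: "'a l2sum \<Rightarrow> 'a l2sum \<Rightarrow> 'a l2sum" is "\<lambda>f g n. f n + g n"
  by (rule l2_seqs_add)

lift_definition scaleR_l2sum :: "real \<Rightarrow> 'a l2sum \<Rightarrow> 'a l2sum" is "\<lambda>r f n. r *\<^sub>R f n"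
  by (rule l2_seqs_bounded_by[where c = "\<bar>r\<bar>" for r]) auto

lift_definition uminus_l2sum :: "'a l2sum \<Rightarrow> 'a l2sum" is "\<lambda>f n. - f n"
  by (rule l2_seqs_bounded_by[where c = 1]) auto

lift_definition minus_l2sum :: "'a l2sum \<Rightarrow> 'a l2sum \<Rightarrow> 'a l2sum" is "\<lambda>f g n. f n - g n"
proof -
  fix f g :: "nat \<Rightarrow> 'a" assume "f \<in> l2_seqs" "g \<in> l2_seqs"
  then have "(\<lambda>n. f n + - g n) \<in> l2_seqs"
    by (intro l2_seqs_add l2_seqs_bounded_by[of g "\<lambda>n. - g n" 1]) auto
  then show "(\<lambda>n. f n - g n) \<in> l2_seqs" by simp
qed

lift_definition inner_l2sum :: "'a l2sum \<Rightarrow> 'a l2sum \<Rightarrow> real"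
  is "\<lambda>f g. \<Sum>n. inner (f n) (g n)" .

definition norm_l2sum :: "'a l2sum \<Rightarrow> real"
  where "norm_l2sum f = sqrt (inner f f)"

definition sgn_l2sum :: "'a l2sum \<Rightarrow> 'a l2sum"
  where "sgn_l2sum f = inverse (norm f) *\<^sub>R f"

definition dist_l2sum :: "'a l2sum \<Rightarrow> 'a l2sum \<Rightarrow> real"
  where "dist_l2sum f g = norm (f - g)"

definition uniformity_l2sum :: "('a l2sum \<times> 'a l2sum) filter"
  where "uniformity_l2sum = (INF e\<in>{0 <..}. principal {(x, y). dist x y < e})"

definition open_l2sum :: "'a l2sum set \<Rightarrow> bool"
  where "open_l2sum S = (\<forall>x\<in>S. \<forall>\<^sub>F (x', y) in uniformity. x' = x \<longrightarrow> y \<in> S)"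

instance
proof
  fix f g h :: "'a l2sum" and r s :: real
  show "f + g + h = f + (g + h)" by transfer (simp add: add.assoc)
  show "f + g = g + f" by transfer (simp add: add.commute)
  show "0 + f = f" by transfer simp
  show "- f + f = 0" by transfer simp
  show "f - g = f + - g" by transfer simp
  show "r *\<^sub>R (f + g) = r *\<^sub>R f + r *\<^sub>R g" by transfer (simp add: scaleR_add_right)
  show "(r + s) *\<^sub>R f = r *\<^sub>R f + s *\<^sub>R f" by transfer (simp add: scaleR_add_left)
  show "r *\<^sub>R s *\<^sub>R f = (r * s) *\<^sub>R f" by transfer simp
  show "1 *\<^sub>R f = f" by transfer simp
  show "sgn f = inverse (norm f) *\<^sub>R f" by (rule sgn_l2sum_def)
  show "dist f g = norm (f - g)" by (rule dist_l2sum_def)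
  show "uniformity = (INF e\<in>{0 <..}. principal {(x, y :: 'a l2sum). dist x y < e})"
    by (rule uniformity_l2sum_def)
  show "open U = (\<forall>x\<in>U. \<forall>\<^sub>F (x', y) in uniformity. x' = x \<longrightarrow> y \<in> U)" for U :: "'a l2sum set"
    by (rule open_l2sum_def)
  show "inner f g = inner g f" by transfer (simp add: inner_commute)
  show "inner (f + g) h = inner f h + inner g h"
    by transfer (simp add: inner_add_left suminf_add l2_seqs_summable_inner)
  show "inner (r *\<^sub>R f) g = r * inner f g"
    by transfer (simp add: suminf_mult l2_seqs_summable_inner)
  show "0 \<le> inner f f"
    by transfer (simp add: suminf_nonneg l2_seqs_summable_inner)
  show "inner f f = 0 \<longleftrightarrow> f = 0"
  proof transfer
    fix f :: "nat \<Rightarrow> 'a" assume "f \<in> l2_seqs"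
    then show "(\<Sum>n. inner (f n) (f n)) = 0 \<longleftrightarrow> f = (\<lambda>n. 0)"
      by (subst suminf_eq_zero_iff) (auto simp: l2_seqs_summable_inner fun_eq_iff)
  qed
  show "norm f = sqrt (inner f f)" by (rule norm_l2sum_def)
qed

end

lemma norm_l2sum_power2: "(norm f)\<^sup>2 = (\<Sum>n. (norm (seq_of f n))\<^sup>2)"
  by (simp add: power2_norm_eq_inner inner_l2sum.rep_eq)

lemma summable_seq_of: "summable (\<lambda>n. (norm (seq_of f n))\<^sup>2)"
  using seq_of[of f] by (simp add: l2_seqs_def)

lemma norm_seq_of_le: "norm (seq_of f n) \<le> norm f"
proof -
  have "(norm (seq_of f n))\<^sup>2 \<le> (norm f)\<^sup>2"
    using sum_le_suminf[OF summable_seq_of, of "{n}" f] by (simp add: norm_l2sum_power2)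
  then show ?thesis by (simp add: power2_le_iff_abs_le)
qed

instance l2sum :: ("{real_inner, complete_space}") complete_space
proof
  fix X :: "nat \<Rightarrow> 'a l2sum"
  assume X: "Cauchy X"
  have "Cauchy (\<lambda>m. seq_of (X m) n)" for n
  proof (rule metric_CauchyI)
    fix e :: real assume "0 < e"
    then obtain N where N: "\<And>i j. i \<ge> N \<Longrightarrow> j \<ge> N \<Longrightarrow> dist (X i) (X j) < e"
      using metric_CauchyD[OF X] by blast
    have "dist (seq_of (X i) n) (seq_of (X j) n) \<le> dist (X i) (X j)" for i j
      using norm_seq_of_le[of "X i - X j" n] by (simp add: dist_norm minus_l2sum.rep_eq)
    then show "\<exists>N. \<forall>i\<ge>N. \<forall>j\<ge>N. dist (seq_of (X i) n) (seq_of (X j) n) < e"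
      using N le_less_trans by blast
  qed
  then have "\<exists>l. (\<lambda>m. seq_of (X m) n) \<longlonglongrightarrow> l" for n
    using Cauchy_convergent convergent_def by blast
  then obtain g where g: "\<And>n. (\<lambda>m. seq_of (X m) n) \<longlonglongrightarrow> g n" by metis
  have tail: "\<exists>N. \<forall>m\<ge>N. \<forall>M. (\<Sum>n<M. (norm (seq_of (X m) n - g n))\<^sup>2) \<le> e\<^sup>2" if "e > 0" for e
  proof -
    obtain N where N: "\<And>i j. i \<ge> N \<Longrightarrow> j \<ge> N \<Longrightarrow> dist (X i) (X j) < e"
      using metric_CauchyD[OF X \<open>e > 0\<close>] by blast
    have "(\<Sum>n<M. (norm (seq_of (X m) n - g n))\<^sup>2) \<le> e\<^sup>2" if "m \<ge> N" for m M
    proof (rule LIMSEQ_le_const2)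
      show "(\<lambda>j. \<Sum>n<M. (norm (seq_of (X m) n - seq_of (X j) n))\<^sup>2)
              \<longlonglongrightarrow> (\<Sum>n<M. (norm (seq_of (X m) n - g n))\<^sup>2)"
        by (intro tendsto_intros g)
      have "(\<Sum>n<M. (norm (seq_of (X m) n - seq_of (X j) n))\<^sup>2) \<le> e\<^sup>2" if "j \<ge> N" for j
      proof -
        have "(\<Sum>n<M. (norm (seq_of (X m) n - seq_of (X j) n))\<^sup>2) \<le> (norm (X m - X j))\<^sup>2"
          using sum_le_suminf[OF summable_seq_of, of "{..<M}" "X m - X j"]
          by (simp add: norm_l2sum_power2 minus_l2sum.rep_eq)
        also have "\<dots> \<le> e\<^sup>2"
          using N[OF \<open>m \<ge> N\<close> that] by (intro power_mono) (auto simp: dist_norm)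
        finally show ?thesis .
      qed
      then show "\<exists>N. \<forall>j\<ge>N. (\<Sum>n<M. (norm (seq_of (X m) n - seq_of (X j) n))\<^sup>2) \<le> e\<^sup>2"
        by blast
    qed
    then show ?thesis by blast
  qed
  have l2: "(\<lambda>n. seq_of (X m) n - g n) \<in> l2_seqs"
    if "\<forall>M. (\<Sum>n<M. (norm (seq_of (X m) n - g n))\<^sup>2) \<le> e\<^sup>2" for m e
    unfolding l2_seqs_def mem_Collect_eq
    using that by (intro summableI_nonneg_bounded[where x = "e\<^sup>2"]) auto
  have gl2: "g \<in> l2_seqs"
  proof -
    obtain N where "\<forall>M. (\<Sum>n<M. (norm (seq_of (X N) n - g n))\<^sup>2) \<le> 1\<^sup>2"
      using tail[of 1] by auto
    from l2[OF this] have "(\<lambda>n. - (seq_of (X N) n - g n)) \<in> l2_seqs"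
      by (rule l2_seqs_bounded_by[where c = 1]) (simp add: norm_minus_commute)
    from l2_seqs_add[OF seq_of[of "X N"] this] show ?thesis by simp
  qed
  have "X \<longlonglongrightarrow> to_l2sum g"
  proof (rule metric_LIMSEQ_I)
    fix e :: real assume "0 < e"
    then obtain N where
      N: "\<And>m M. m \<ge> N \<Longrightarrow> (\<Sum>n<M. (norm (seq_of (X m) n - g n))\<^sup>2) \<le> (e/2)\<^sup>2"
      using tail[of "e/2"] by auto
    have "dist (X m) (to_l2sum g) < e" if "m \<ge> N" for m
    proof -
      have "(norm (X m - to_l2sum g))\<^sup>2 = (\<Sum>n. (norm (seq_of (X m) n - g n))\<^sup>2)"
        by (simp add: norm_l2sum_power2 minus_l2sum.rep_eq to_l2sum_inverse[OF gl2])
      also have "\<dots> \<le> (e/2)\<^sup>2"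
        using N[OF that] l2[of m "e/2"] by (intro suminf_le_const) (auto simp: l2_seqs_def)
      finally have "norm (X m - to_l2sum g) \<le> e/2"
        using \<open>0 < e\<close> by (simp add: power2_le_iff_abs_le)
      then show ?thesis using \<open>0 < e\<close> by (simp add: dist_norm)
    qed
    then show "\<exists>N. \<forall>m\<ge>N. dist (X m) (to_l2sum g) < e" by blast
  qed
  then show "convergent X" by (rule convergentI)
qed

lemma l2_seqs_scaleC:
  fixes f :: "nat \<Rightarrow> 'a::complex_inner"
  assumes "f \<in> l2_seqs"
  shows "(\<lambda>n. c *\<^sub>C f n) \<in> l2_seqs"
  using assms by (rule l2_seqs_bounded_by[where c = "cmod c"]) (simp add: norm_scaleC)

lemma l2_seqs_summable_cinner:
  fixes f g :: "nat \<Rightarrow> 'a::complex_inner"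
  assumes "f \<in> l2_seqs" "g \<in> l2_seqs"
  shows "summable (\<lambda>n. cinner (f n) (g n))"
  unfolding summable_complex_iff cinner_eq_inner complex.sel
  using l2_seqs_summable_inner[OF assms] l2_seqs_summable_inner[OF assms(1) l2_seqs_scaleC[OF assms(2)]]
  by simp

instantiation l2sum :: (complex_inner) complex_inner
begin

lift_definition scaleC_l2sum :: "complex \<Rightarrow> 'a l2sum \<Rightarrow> 'a l2sum" is "\<lambda>c f n. c *\<^sub>C f n"
  by (rule l2_seqs_scaleC)

lift_definition cinner_l2sum :: "'a l2sum \<Rightarrow> 'a l2sum \<Rightarrow> complex"
  is "\<lambda>f g. \<Sum>n. cinner (f n) (g n)" .

instance
proof
  fix f g h :: "'a l2sum" and c d :: complex and r :: real
  show "c *\<^sub>C (f + g) = c *\<^sub>C f + c *\<^sub>C g" by transfer (simp add: scaleC_add_right)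
  show "(c + d) *\<^sub>C f = c *\<^sub>C f + d *\<^sub>C f" by transfer (simp add: scaleC_add_left)
  show "c *\<^sub>C d *\<^sub>C f = (c * d) *\<^sub>C f" by transfer (simp add: scaleC_scaleC)
  show "r *\<^sub>R f = complex_of_real r *\<^sub>C f" by transfer (simp add: scaleR_scaleC)
  show "cinner f g = cnj (cinner g f)"
  proof transfer
    fix f g :: "nat \<Rightarrow> 'a" assume fg: "f \<in> l2_seqs" "g \<in> l2_seqs"
    have "(\<lambda>n. cnj (cinner (g n) (f n))) sums cnj (\<Sum>n. cinner (g n) (f n))"
      unfolding sums_cnj by (rule summable_sums[OF l2_seqs_summable_cinner[OF fg(2,1)]])
    then show "(\<Sum>n. cinner (f n) (g n)) = cnj (\<Sum>n. cinner (g n) (f n))"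
      by (subst cinner_commute) (simp add: sums_iff)
  qed
  show "cinner (f + g) h = cinner f h + cinner g h"
    by transfer (simp add: cinner_add_left suminf_add l2_seqs_summable_cinner)
  show "cinner (c *\<^sub>C f) g = c * cinner f g"
    by transfer (simp add: cinner_scaleC_left suminf_mult l2_seqs_summable_cinner)
  show "inner f g = Re (cinner f g)"
    by transfer (simp add: inner_eq_Re_cinner Re_suminf l2_seqs_summable_cinner)
qed

end


text \<open>
  Infinite matrices with entries in a scalar type \<open>'k\<close>, acting on sequences of vectors through
  a scalar multiplication \<open>sc\<close> (\<open>scaleR\<close> for real and \<open>scaleC\<close> for complex Hilbert spaces).
  Series converge in norm.
\<close>

definition matrix_apply ::
  "('k \<Rightarrow> 'a \<Rightarrow> 'a) \<Rightarrow> (nat \<Rightarrow> nat \<Rightarrow> 'k) \<Rightarrow> (nat \<Rightarrow> 'a::real_normed_vector) \<Rightarrow> nat \<Rightarrow> 'a"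
  where "matrix_apply sc E x = (\<lambda>n. \<Sum>k. sc (E n k) (x k))"

definition defines_matrix_mapping ::
  "('k \<Rightarrow> 'a \<Rightarrow> 'a) \<Rightarrow> (nat \<Rightarrow> nat \<Rightarrow> 'k) \<Rightarrow> (nat \<Rightarrow> 'a::real_normed_vector) set \<Rightarrow> bool"
  where "defines_matrix_mapping sc E X \<longleftrightarrow>
    (\<forall>x\<in>X. (\<forall>n. summable (\<lambda>k. sc (E n k) (x k))) \<and> matrix_apply sc E x \<in> X)"

text \<open>
  The induced map on the direct sum. It is meaningful only if \<open>E\<close> defines a matrix mapping on
  \<open>l2_seqs\<close>, since \<open>to_l2sum\<close> is unspecified outside \<open>l2_seqs\<close>.
\<close>

definition matrix_operator ::
  "('k \<Rightarrow> 'a \<Rightarrow> 'a) \<Rightarrow> (nat \<Rightarrow> nat \<Rightarrow> 'k) \<Rightarrow> 'a::real_inner l2sum \<Rightarrow> 'a l2sum"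
  where "matrix_operator sc E \<Psi> = to_l2sum (matrix_apply sc E (seq_of \<Psi>))"

end

theory Submission
  imports Defs
begin

text \<open>
  The theorem is an automatic continuity statement, and the principle behind it is the
  Banach--Steinhaus theorem: on a complete normed space, the pointwise limit of a sequence of
  bounded linear operators is again a bounded linear operator
  (\<open>bounded_linear_pointwise_limit\<close>). The principle is used twice.

  Write \<open>H\<close> for the Hilbert space. Each coordinate \<open>\<Psi> \<mapsto> (E\<Psi>)\<^sub>n = \<Sum>k. E\<^sub>n\<^sub>k \<psi>\<^sub>k\<close> is the
  pointwise limit of its partial sums, which are bounded because they involve finitely many
  coordinates of \<open>\<Psi>\<close>. The hypothesis that the series converge for every \<open>\<Psi>\<close> therefore makes
  every coordinate a bounded operator from the direct sum to \<open>H\<close>. Next, the hypothesis that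
  \<open>E\<Psi>\<close> is square summable says that \<open>E\<Psi>\<close> is the norm limit of its truncations
  \<open>((E\<Psi>)\<^sub>0, \<dots>, (E\<Psi>)\<^sub>N\<^sub>-\<^sub>1, 0, 0, \<dots>)\<close>. Each truncation is bounded by the first step, so \<open>E\<close>
  is bounded by a second application of the principle
  (\<open>bounded_linear_into_l2sum\<close>).

  Nothing in this depends on the scalars, so the argument is carried out for an arbitrary
  scalar multiplication \<open>sc\<close> that is bounded and real linear in the vector; complex
  homogeneity of the induced operator is then checked separately.
\<close>

text \<open>
  The sets on which the family is bounded by a natural number are closed and cover the space,
  so by the Baire category theorem one of them contains a ball. Each vector is a multiple of a
  difference of two points of that ball, so the bound on the ball controls the operator norms.
\<close>

lemma uniform_boundedness:
  fixes T :: "'i \<Rightarrow> 'x::{real_normed_vector, complete_space} \<Rightarrow> 'y::real_normed_vector"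
  assumes lin: "\<And>i. bounded_linear (T i)"
    and ptw: "\<And>x. \<exists>c. \<forall>i. norm (T i x) \<le> c"
  shows "\<exists>M. \<forall>i x. norm (T i x) \<le> M * norm x"
proof -
  define B where "B m = {x. \<forall>i. norm (T i x) \<le> real m}" for m :: nat
  have B_closed: "closed (B m)" for m
    unfolding B_def
    by (intro closed_Collect_all closed_Collect_le continuous_intros
        linear_continuous_on[OF lin])
  have B_cover: "(\<Union>m. B m) = UNIV"
  proof -
    have "\<exists>m. x \<in> B m" for x
    proof -
      obtain c where c: "\<forall>i. norm (T i x) \<le> c" using ptw by blast
      obtain m :: nat where "c \<le> real m" using real_arch_simple by blast
      with c have "x \<in> B m" unfolding B_def by (auto intro: order_trans)
      then show ?thesis ..
    qed
    then show ?thesis by auto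
  qed
  have "\<exists>m. interior (B m) \<noteq> {}"
  proof (rule ccontr)
    assume "\<not> ?thesis"
    then have "euclidean interior_of (\<Union>(range B)) = {}"
      using B_closed
      by (intro Baire_category_alt)
        (auto simp: completely_metrizable_space_euclidean)
    then show False by (simp add: B_cover)
  qed
  then obtain m a where "a \<in> interior (B m)" by blast
  then obtain r where "r > 0" and r: "cball a r \<subseteq> B m"
    by (auto simp: mem_interior_cball)
  have "norm (T i x) \<le> (2 * real m / r) * norm x" for i x
  proof (cases "x = 0")
    case True
    then show ?thesis by (simp add: linear_simps(3)[OF lin])
  next
    case False
    define u where "u = (r / norm x) *\<^sub>R x"
    have "norm u = r" using False \<open>r > 0\<close> by (simp add: u_def)
    then have "a + u \<in> B m" "a \<in> B m" using r \<open>r > 0\<close> by (auto simp: dist_norm)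
    then have "norm (T i (a + u)) \<le> real m" "norm (T i a) \<le> real m"
      by (auto simp: B_def)
    moreover have "T i u = T i (a + u) - T i a" by (simp add: linear_simps(1)[OF lin])
    ultimately have "norm (T i u) \<le> 2 * real m"
      using norm_triangle_ineq4[of "T i (a + u)" "T i a"] by simp
    moreover have "norm (T i u) = (r / norm x) * norm (T i x)"
      using \<open>r > 0\<close> by (simp add: u_def linear_simps(5)[OF lin])
    ultimately show ?thesis using False \<open>r > 0\<close> by (simp add: field_simps)
  qed
  then show ?thesis by blast
qed

lemma bounded_linear_pointwise_limit:
  fixes T :: "nat \<Rightarrow> 'x::{real_normed_vector, complete_space} \<Rightarrow> 'y::real_normed_vector"
  assumes lin: "\<And>n. bounded_linear (T n)"
    and lim: "\<And>x. (\<lambda>n. T n x) \<longlonglongrightarrow> S x"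
  shows "bounded_linear S"
proof -
  have "\<exists>c. \<forall>n. norm (T n x) \<le> c" for x
    using convergent_imp_Bseq[OF convergentI[OF lim[of x]]] by (auto simp: Bseq_def)
  from uniform_boundedness[of T, OF lin this]
  obtain M where M: "\<And>n x. norm (T n x) \<le> M * norm x" by blast
  show ?thesis
  proof (rule bounded_linear_intro)
    fix x y :: 'x and c :: real
    have "(\<lambda>n. T n (x + y)) \<longlonglongrightarrow> S x + S y"
      unfolding linear_simps(1)[OF lin] by (intro tendsto_add lim)
    then show "S (x + y) = S x + S y" using lim LIMSEQ_unique by blast
    have "(\<lambda>n. T n (c *\<^sub>R x)) \<longlonglongrightarrow> c *\<^sub>R S x"
      unfolding linear_simps(5)[OF lin] by (intro tendsto_scaleR tendsto_const lim)
    then show "S (c *\<^sub>R x) = c *\<^sub>R S x" using lim LIMSEQ_unique by blast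
    show "norm (S x) \<le> norm x * M"
      using M by (intro LIMSEQ_le_const2[OF tendsto_norm[OF lim]]) (auto simp: mult.commute)
  qed
qed

lemma bounded_linear_seq_of: "bounded_linear (\<lambda>f. seq_of f n)"
  by (rule bounded_linear_intro[where K = 1])
    (auto simp: plus_l2sum.rep_eq scaleR_l2sum.rep_eq norm_seq_of_le)

lift_definition l2sum_single :: "nat \<Rightarrow> 'a::real_inner \<Rightarrow> 'a l2sum"
  is "\<lambda>n v j. if j = n then v else 0"
  unfolding l2_seqs_def mem_Collect_eq
  by (rule summable_finite[where N = "{n}" for n]) auto

lemma norm_l2sum_single: "norm (l2sum_single n v) = norm v"
proof -
  have "(\<Sum>j. (norm (if j = n then v else 0))\<^sup>2) = (norm v)\<^sup>2"
    by (subst suminf_finite[where N = "{n}"]) auto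
  then have "(norm (l2sum_single n v))\<^sup>2 = (norm v)\<^sup>2"
    by (simp add: norm_l2sum_power2 l2sum_single.rep_eq)
  then show ?thesis by simp
qed

lemma bounded_linear_l2sum_single: "bounded_linear (l2sum_single n)"
  by (rule bounded_linear_intro[where K = 1])
    (simp_all add: norm_l2sum_single, (transfer, force)+)

lemma seq_of_sum: "seq_of (\<Sum>i\<in>I. f i) j = (\<Sum>i\<in>I. seq_of (f i) j)"
  using linear_sum[OF bounded_linear.linear[OF bounded_linear_seq_of]] .

text \<open>
  The squared distance of a sequence from its truncation is a tail of the convergent series of
  squared norms.
\<close>

lemma l2sum_truncations_tendsto: "(\<lambda>N. \<Sum>n<N. l2sum_single n (seq_of f n)) \<longlonglongrightarrow> f"
proof -
  define g where "g N = (\<Sum>n<N. l2sum_single n (seq_of f n))" for N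
  have g: "seq_of (g N) j = (if j < N then seq_of f j else 0)" for N j
    by (simp add: g_def seq_of_sum l2sum_single.rep_eq)
  have "(norm (g N - f))\<^sup>2 = (\<Sum>n. (norm (seq_of f (n + N)))\<^sup>2)" for N
  proof -
    have eq: "(norm (seq_of (g N - f) j))\<^sup>2 = (if j < N then 0 else (norm (seq_of f j))\<^sup>2)"
      for j by (simp add: minus_l2sum.rep_eq g)
    have "(norm (g N - f))\<^sup>2 = (\<Sum>j. (norm (seq_of (g N - f) (j + N)))\<^sup>2)
        + (\<Sum>j<N. (norm (seq_of (g N - f) j))\<^sup>2)"
      unfolding norm_l2sum_power2 by (rule suminf_split_initial_segment[OF summable_seq_of])
    then show ?thesis by (simp add: eq)
  qed
  then have "(\<lambda>N. (norm (g N - f))\<^sup>2) \<longlonglongrightarrow> 0"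
    using suminf_exist_split2[OF summable_seq_of[of f]] by simp
  then have "(\<lambda>N. norm (g N - f)) \<longlonglongrightarrow> 0"
    using tendsto_real_sqrt[of "\<lambda>N. (norm (g N - f))\<^sup>2" 0] by simp
  then show ?thesis
    unfolding g_def[symmetric] by (rule LIM_zero_cancel[OF tendsto_norm_zero_cancel])
qed

text \<open>
  A map into the direct sum is the pointwise limit of its truncations, which are bounded as
  finite sums of bounded coordinates.
\<close>

lemma bounded_linear_into_l2sum:
  fixes T :: "'x::{real_normed_vector, complete_space} \<Rightarrow> 'a::real_inner l2sum"
  assumes "\<And>n. bounded_linear (\<lambda>x. seq_of (T x) n)"
  shows "bounded_linear T"
proof (rule bounded_linear_pointwise_limit)
  show "bounded_linear (\<lambda>x. \<Sum>n<N. l2sum_single n (seq_of (T x) n))" for N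
    by (intro bounded_linear_sum bounded_linear_compose[OF bounded_linear_l2sum_single] assms)
  show "(\<lambda>N. \<Sum>n<N. l2sum_single n (seq_of (T x) n)) \<longlonglongrightarrow> T x" for x
    by (rule l2sum_truncations_tendsto)
qed

lemma seq_of_matrix_operator:
  assumes "defines_matrix_mapping sc E (l2_seqs :: (nat \<Rightarrow> 'a::real_inner) set)"
  shows "seq_of (matrix_operator sc E \<Psi>) n = (\<Sum>k. sc (E n k) (seq_of (\<Psi> :: 'a l2sum) k))"
  using assms seq_of[of \<Psi>]
  by (simp add: defines_matrix_mapping_def matrix_operator_def to_l2sum_inverse)
    (simp add: matrix_apply_def)

lemma matrix_row_summable:
  assumes "defines_matrix_mapping sc E (l2_seqs :: (nat \<Rightarrow> 'a::real_inner) set)"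
  shows "summable (\<lambda>k. sc (E n k) (seq_of (\<Psi> :: 'a l2sum) k))"
  using assms seq_of[of \<Psi>] by (auto simp: defines_matrix_mapping_def)

lemma bounded_linear_matrix_operator:
  fixes sc :: "'k \<Rightarrow> 'a::{real_inner, complete_space} \<Rightarrow> 'a"
  assumes sc: "\<And>c. bounded_linear (sc c)"
    and E: "defines_matrix_mapping sc E (l2_seqs :: (nat \<Rightarrow> 'a) set)"
  shows "bounded_linear (matrix_operator sc E)"
proof (rule bounded_linear_into_l2sum)
  fix n
  have "bounded_linear (\<lambda>\<Psi>. \<Sum>k. sc (E n k) (seq_of \<Psi> k))"
  proof (rule bounded_linear_pointwise_limit)
    show "bounded_linear (\<lambda>\<Psi>. \<Sum>k<N. sc (E n k) (seq_of \<Psi> k))" for N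
      by (intro bounded_linear_sum bounded_linear_compose[OF sc] bounded_linear_seq_of)
    show "(\<lambda>N. \<Sum>k<N. sc (E n k) (seq_of \<Psi> k)) \<longlonglongrightarrow> (\<Sum>k. sc (E n k) (seq_of \<Psi> k))" for \<Psi>
      by (rule summable_LIMSEQ[OF matrix_row_summable[OF E]])
  qed
  then show "bounded_linear (\<lambda>\<Psi>. seq_of (matrix_operator sc E \<Psi>) n)"
    unfolding seq_of_matrix_operator[OF E] .
qed

lemma bounded_linear_scaleC: "bounded_linear (scaleC c :: 'a::complex_inner \<Rightarrow> 'a)"
proof (rule bounded_linear_intro)
  fix x y :: 'a and r :: real
  show "c *\<^sub>C (x + y) = c *\<^sub>C x + c *\<^sub>C y" by (rule scaleC_add_right)
  show "c *\<^sub>C r *\<^sub>R x = r *\<^sub>R c *\<^sub>C x" by (simp add: scaleR_scaleC scaleC_scaleC mult.commute)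
  show "norm (c *\<^sub>C x) \<le> norm x * cmod c" by (simp add: norm_scaleC)
qed

lemma matrix_operator_scaleC:
  fixes \<Psi> :: "'a::complex_inner l2sum"
  assumes F: "defines_matrix_mapping scaleC F (l2_seqs :: (nat \<Rightarrow> 'a) set)"
  shows "matrix_operator scaleC F (c *\<^sub>C \<Psi>) = c *\<^sub>C matrix_operator scaleC F \<Psi>"
proof -
  have "seq_of (matrix_operator scaleC F (c *\<^sub>C \<Psi>)) n
      = seq_of (c *\<^sub>C matrix_operator scaleC F \<Psi>) n" for n
    using bounded_linear.suminf[OF bounded_linear_scaleC matrix_row_summable[OF F], of c n \<Psi>]
    by (simp add: seq_of_matrix_operator[OF F] scaleC_l2sum.rep_eq scaleC_scaleC mult.commute)
  then show ?thesis by (simp add: seq_of_inject[symmetric] fun_eq_iff)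
qed

theorem theorem2p4:
  fixes E :: "nat \<Rightarrow> nat \<Rightarrow> real"
    and F :: "nat \<Rightarrow> nat \<Rightarrow> complex"
  shows
    "(separable_space (euclidean :: 'h::{real_inner, complete_space} topology) \<longrightarrow>
      defines_matrix_mapping scaleR E (l2_seqs :: (nat \<Rightarrow> 'h) set) \<longrightarrow>
      bounded_linear (matrix_operator scaleR E :: 'h l2sum \<Rightarrow> 'h l2sum))
   \<and> (separable_space (euclidean :: 'g::{complex_inner, complete_space} topology) \<longrightarrow>
      defines_matrix_mapping scaleC F (l2_seqs :: (nat \<Rightarrow> 'g) set) \<longrightarrow>
      bounded_clinear (matrix_operator scaleC F :: 'g l2sum \<Rightarrow> 'g l2sum))"
  by (simp add: bounded_clinear_def matrix_operator_scaleC bounded_linear_matrix_operator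
      bounded_linear_scaleR_right bounded_linear_scaleC)

end
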